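(* Let $\mathbb{F}_q$ be a finite field with $q$ elements, let $\ell$ be a prime with $\gcd(\ell,q)=1$, let $s=\nu_\ell(q-1)\ge 1$ be the exponent of the largest power of $\ell$ dividing $q-1$, and assume $s\neq 1$ if $\ell=2$. Fix a primitive $\ell^s$-th root of unity $\mu_s\in\mathbb{F}_q^*$ and put $\mu_j=\mu_s^{\ell^{s-j}}$ for $0\le j\le s$. Let $n\ge 1$, $1\le k\le s$, and $r=\min\{n,s-k\}$. Let $C_k$ be the $\mu_k$-constacyclic $[\ell^n,\ell^{n-r}]_q$ code with parity check polynomial $x^{\ell^{n-r}}-\mu_{k+r}$. Then the weight distribution of $C_k$ is given by $$A_{\ell^r j}=\binom{\ell^{n-r}}{j}(q-1)^j\qquad\text{for } 0\le j\le \ell^{n-r},$$ where $A_i$ denotes the number of codewords of $C_k$ of Hamming weight $i$.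
   Context: For $\mu\in\mathbb{F}_q^*$ and $m\ge 1$, a linear code $C\subseteq\mathbb{F}_q^m$ is $\mu$-constacyclic if $(c_1,\dots,c_{m-1},\mu c_0)\in C$ whenever $(c_0,\dots,c_{m-1})\in C$. A vector $(a_0,\dots,a_{m-1})$ is identified with the polynomial $a_0x^{m-1}+\cdots+a_{m-1}$ modulo $x^m-\mu$; with $\gcd(m,q)=1$, $\mu$-constacyclic codes are ideals $\langle g(x)\rangle$ of $\mathbb{F}_q[x]/\langle x^m-\mu\rangle$ with $g$ a monic divisor of $x^m-\mu$, and $(x^m-\mu)/g(x)$ is the parity check polynomial. The Hamming weight of a vector is its number of nonzero coordinates. *)

theory Defs
  imports
    "Jordan_Normal_Form.VS_Connect"
    "HOL-Computational_Algebra.Primes"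
    "HOL-Library.Cardinality"
begin

definition primitive_root_of_unity :: "nat \<Rightarrow> 'a :: field \<Rightarrow> bool" where
  "primitive_root_of_unity N z \<longleftrightarrow> N > 0 \<and> z ^ N = 1 \<and> (\<forall>d. 0 < d \<and> d < N \<longrightarrow> z ^ d \<noteq> 1)"

text \<open>An \<open>[m, d]\<close> linear code: a \<open>d\<close>-dimensional linear subspace of \<open>F\<^sup>m\<close>.\<close>

definition linear_code :: "nat \<Rightarrow> nat \<Rightarrow> 'a :: field vec set \<Rightarrow> bool" where
  "linear_code m d C \<longleftrightarrow>
     VectorSpace.subspace class_ring C (module_vec TYPE('a) m) \<and>
     vectorspace.dim class_ring (module_vec TYPE('a) m\<lparr>carrier := C\<rparr>) = d"

definition constacyclic_shift :: "'a :: field \<Rightarrow> 'a vec \<Rightarrow> 'a vec" where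
  "constacyclic_shift \<mu> c =
     vec (dim_vec c) (\<lambda>i. if i + 1 < dim_vec c then c $ (i + 1) else \<mu> * c $ 0)"

definition constacyclic :: "'a :: field \<Rightarrow> 'a vec set \<Rightarrow> bool" where
  "constacyclic \<mu> C \<longleftrightarrow> \<mu> \<noteq> 0 \<and> (\<forall>c\<in>C. constacyclic_shift \<mu> c \<in> C)"

text \<open>The leading entry is the coefficient of the highest power:
  \<open>(a\<^sub>0, \<dots>, a\<^sub>m\<^sub>-\<^sub>1)\<close> is identified with \<open>a\<^sub>0 x\<^sup>m\<^sup>-\<^sup>1 + \<dots> + a\<^sub>m\<^sub>-\<^sub>1\<close>.\<close>

definition vec_poly :: "'a :: field vec \<Rightarrow> 'a poly" where
  "vec_poly c = (\<Sum>i<dim_vec c. monom (c $ i) (dim_vec c - 1 - i))"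

definition binom_poly :: "nat \<Rightarrow> 'a :: field \<Rightarrow> 'a poly" where
  "binom_poly m \<mu> = monom 1 m - [:\<mu>:]"

text \<open>The vectors of length \<open>m\<close> whose residue class modulo \<open>x\<^sup>m - \<mu>\<close> lies in the
  principal ideal generated by the class of \<open>g\<close>.\<close>

definition ideal_code :: "'a :: field \<Rightarrow> nat \<Rightarrow> 'a poly \<Rightarrow> 'a vec set" where
  "ideal_code \<mu> m g = {c \<in> carrier_vec m. \<exists>f. binom_poly m \<mu> dvd vec_poly c - f * g}"

definition parity_check_polynomial ::
    "'a :: field \<Rightarrow> nat \<Rightarrow> 'a vec set \<Rightarrow> 'a poly \<Rightarrow> bool" where
  "parity_check_polynomial \<mu> m C h \<longleftrightarrow>
     (\<exists>g. lead_coeff g = 1 \<and> g * h = binom_poly m \<mu> \<and> C = ideal_code \<mu> m g)"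

definition hamming_weight :: "'a :: zero vec \<Rightarrow> nat" where
  "hamming_weight c = card {i. i < dim_vec c \<and> c $ i \<noteq> 0}"

definition weight_count :: "'a :: zero vec set \<Rightarrow> nat \<Rightarrow> nat" where
  "weight_count C i = card {c \<in> C. hamming_weight c = i}"

text \<open>Every monic factorisation \<open>x\<^sup>m - \<mu> = g h\<close> yields a \<open>\<mu>\<close>-constacyclic
  \<open>[m, deg h]\<close> code with parity check polynomial \<open>h\<close>, and \<open>h\<close> determines that code.\<close>

lemma coeff_vec_poly:
  "coeff (vec_poly c) j = (if j < dim_vec c then c $ (dim_vec c - 1 - j) else 0)"
proof -
  have "coeff (vec_poly c) j =
      (\<Sum>i<dim_vec c. if i = dim_vec c - 1 - j then (if j < dim_vec c then c $ i else 0) else 0)"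
    unfolding vec_poly_def coeff_sum coeff_monom by (rule sum.cong) auto
  thus ?thesis by (auto simp: sum.delta)
qed

lemma vec_poly_add:
  "c \<in> carrier_vec m \<Longrightarrow> d \<in> carrier_vec m \<Longrightarrow> vec_poly (c + d) = vec_poly c + vec_poly d"
  by (rule poly_eqI) (auto simp: coeff_vec_poly)

lemma vec_poly_smult: "vec_poly (a \<cdot>\<^sub>v c) = Polynomial.smult a (vec_poly c)"
  by (rule poly_eqI) (auto simp: coeff_vec_poly)

lemma vec_poly_zero: "vec_poly (0\<^sub>v m) = 0"
  by (rule poly_eqI) (auto simp: coeff_vec_poly)

lemma vec_poly_inj: "inj_on vec_poly (carrier_vec m)"
proof (rule inj_onI)
  fix c d :: "'a vec"
  assume cd: "c \<in> carrier_vec m" "d \<in> carrier_vec m" "vec_poly c = vec_poly d"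
  show "c = d"
  proof (rule eq_vecI)
    fix i assume "i < dim_vec d"
    with cd have i: "i < m" "dim_vec c = m" "dim_vec d = m" by auto
    have "coeff (vec_poly c) (m - 1 - i) = coeff (vec_poly d) (m - 1 - i)" using cd by simp
    thus "c $ i = d $ i" using i by (simp add: coeff_vec_poly)
  qed (use cd in auto)
qed

lemma vec_poly_surj:
  assumes "p = 0 \<or> degree p < m"
  obtains c where "c \<in> carrier_vec m" "vec_poly c = p"
proof
  let ?c = "vec m (\<lambda>i. coeff p (m - 1 - i))"
  show "?c \<in> carrier_vec m" by simp
  show "vec_poly ?c = p"
    by (rule poly_eqI) (use assms in \<open>auto simp: coeff_vec_poly coeff_eq_0\<close>)
qed

lemma vec_poly_degree:
  assumes "c \<in> carrier_vec m"
  shows "vec_poly c = 0 \<or> degree (vec_poly c) < m"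
proof (rule ccontr)
  assume *: "\<not> ?thesis"
  hence "coeff (vec_poly c) (degree (vec_poly c)) = 0" using assms by (simp add: coeff_vec_poly)
  with * show False by simp
qed

lemma vec_poly_shift:
  assumes "c \<in> carrier_vec m" "m > 0"
  shows "vec_poly (constacyclic_shift \<mu> c) =
    [:0, 1:] * vec_poly c - Polynomial.smult (c $ 0) (binom_poly m \<mu>)"
proof (rule poly_eqI)
  fix j
  show "coeff (vec_poly (constacyclic_shift \<mu> c)) j =
    coeff ([:0, 1:] * vec_poly c - Polynomial.smult (c $ 0) (binom_poly m \<mu>)) j"
    using assms
    by (cases j) (auto simp: coeff_vec_poly constacyclic_shift_def binom_poly_def coeff_pCons
        Suc_diff_Suc split: nat.splits)
qed

lemma lead_coeff_binom_poly: "m > 0 \<Longrightarrow> lead_coeff (binom_poly m \<mu>) = 1"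
  and degree_binom_poly: "m > 0 \<Longrightarrow> degree (binom_poly m \<mu>) = m"
proof -
  assume m: "m > 0"
  have c: "coeff (binom_poly m \<mu>) m = 1" using m
    by (auto simp: binom_poly_def coeff_pCons split: nat.splits)
  have "degree (binom_poly m \<mu>) \<le> m"
    by (rule degree_le) (auto simp: binom_poly_def coeff_pCons split: nat.splits)
  moreover have "m \<le> degree (binom_poly m \<mu>)" by (rule le_degree) (simp add: c)
  ultimately show "degree (binom_poly m \<mu>) = m" by simp
  with c show "lead_coeff (binom_poly m \<mu>) = 1" by simp
qed

lemma ideal_code_iff:
  assumes "g dvd binom_poly m \<mu>"
  shows "c \<in> ideal_code \<mu> m g \<longleftrightarrow> c \<in> carrier_vec m \<and> g dvd vec_poly c"
proof
  assume "c \<in> ideal_code \<mu> m g"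
  then obtain f where "c \<in> carrier_vec m" "binom_poly m \<mu> dvd vec_poly c - f * g"
    by (auto simp: ideal_code_def)
  moreover from this(2) assms have "g dvd vec_poly c - f * g" by (rule dvd_trans[rotated])
  hence "g dvd (vec_poly c - f * g) + f * g" by (rule dvd_add) simp
  ultimately show "c \<in> carrier_vec m \<and> g dvd vec_poly c" by simp
next
  assume "c \<in> carrier_vec m \<and> g dvd vec_poly c"
  then obtain f where "c \<in> carrier_vec m" "vec_poly c = g * f" by (auto elim: dvdE)
  thus "c \<in> ideal_code \<mu> m g"
    by (auto simp: ideal_code_def intro!: exI[of _ f] simp: mult.commute)
qed

lemma constacyclic_ideal_code:
  assumes "g dvd binom_poly m \<mu>" "m > 0" "\<mu> \<noteq> 0"
  shows "constacyclic \<mu> (ideal_code \<mu> m g)"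
  unfolding constacyclic_def
proof (intro conjI ballI)
  fix c assume "c \<in> ideal_code \<mu> m g"
  hence c: "c \<in> carrier_vec m" "g dvd vec_poly c" using assms by (auto simp: ideal_code_iff)
  have "constacyclic_shift \<mu> c \<in> carrier_vec m"
    using c by (auto simp: constacyclic_shift_def)
  moreover have "g dvd vec_poly (constacyclic_shift \<mu> c)"
    unfolding vec_poly_shift[OF c(1) assms(2)]
    using c assms by (intro dvd_diff dvd_mult dvd_smult)
  ultimately show "constacyclic_shift \<mu> c \<in> ideal_code \<mu> m g"
    using assms by (simp add: ideal_code_iff)
qed (use assms in simp)

lemma linear_code_ideal_code:
  fixes g h :: "'a :: field poly"
  assumes gh: "g * h = binom_poly m \<mu>" and m: "m > 0"
  shows "linear_code m (degree h) (ideal_code \<mu> m g)"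
proof -
  let ?C = "ideal_code \<mu> m g" and ?d = "degree h"
  let ?V = "module_vec TYPE('a) m"
  interpret V: vec_space "TYPE('a)" m .
  interpret U: vec_space "TYPE('a)" ?d .
  have dvd: "g dvd binom_poly m \<mu>" using gh by (metis dvd_triv_left)
  note iff = ideal_code_iff[OF dvd]
  have nz: "g \<noteq> 0" "h \<noteq> 0" using gh m degree_binom_poly[of m \<mu>] by auto
  have deg: "degree g + ?d = m"
    using degree_mult_eq[OF nz] degree_binom_poly[OF m, of \<mu>] gh by simp
  have sub: "VectorSpace.subspace class_ring ?C ?V"
  proof (intro VectorSpace.subspace.intro submodule.intro)
    show "vectorspace class_ring ?V" ..
    show "module class_ring ?V" ..
  qed (auto simp: iff module_vec_simps vec_poly_add vec_poly_smult vec_poly_zero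
        class_ring_simps intro: dvd_smult)
  define T where "T u = (THE c. c \<in> carrier_vec m \<and> vec_poly c = g * vec_poly u)" for u
  have T: "T u \<in> carrier_vec m \<and> vec_poly (T u) = g * vec_poly u"
    if u: "u \<in> carrier_vec ?d" for u
  proof -
    have "g * vec_poly u = 0 \<or> degree (g * vec_poly u) < m"
      using vec_poly_degree[OF u] nz deg by (cases "vec_poly u = 0") (auto simp: degree_mult_eq)
    then obtain c where c: "c \<in> carrier_vec m" "vec_poly c = g * vec_poly u"
      by (rule vec_poly_surj)
    show ?thesis unfolding T_def
      by (rule theI[of _ c]) (use c vec_poly_inj[of m] in \<open>auto simp: inj_on_def\<close>)
  qed
  have TI: "T u = c"
    if "u \<in> carrier_vec ?d" "c \<in> carrier_vec m" "vec_poly c = g * vec_poly u" for u c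
    using T[OF that(1)] that vec_poly_inj[of m] by (auto simp: inj_on_def)
  have vsC: "vectorspace class_ring (?V\<lparr>carrier := ?C\<rparr>)"
    by (rule V.subspace_is_vs[OF sub])
  interpret W: vectorspace class_ring "?V\<lparr>carrier := ?C\<rparr>" by (rule vsC)
  have hom: "T \<in> LinearCombinations.module_hom class_ring (module_vec TYPE('a) ?d) (?V\<lparr>carrier := ?C\<rparr>)"
  proof -
    have "T (u + v) = T u + T v" if "u \<in> carrier_vec ?d" "v \<in> carrier_vec ?d" for u v
      using T[OF that(1)] T[OF that(2)] that
      by (intro TI) (auto simp: vec_poly_add[of _ m] vec_poly_add[of _ ?d] distrib_left)
    moreover have "T (a \<cdot>\<^sub>v u) = a \<cdot>\<^sub>v T u" if "u \<in> carrier_vec ?d" for a u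
      using T[OF that] that by (intro TI) (auto simp: vec_poly_smult)
    moreover have "T u \<in> ?C" if "u \<in> carrier_vec ?d" for u
      using T[OF that] by (simp add: iff)
    ultimately show ?thesis
      by (auto simp: LinearCombinations.module_hom_def module_vec_simps class_ring_simps)
  qed
  interpret T: linear_map class_ring "module_vec TYPE('a) ?d" "?V\<lparr>carrier := ?C\<rparr>" T
    by unfold_locales (rule hom)
  have inj: "inj_on T (carrier (module_vec TYPE('a) ?d))"
  proof (rule inj_onI)
    fix u v assume uv: "u \<in> carrier (module_vec TYPE('a) ?d)"
      "v \<in> carrier (module_vec TYPE('a) ?d)" "T u = T v"
    hence c: "u \<in> carrier_vec ?d" "v \<in> carrier_vec ?d" by (auto simp: module_vec_simps)
    have "g * vec_poly u = g * vec_poly v" using T[OF c(1)] T[OF c(2)] uv(3) by metis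
    hence "vec_poly u = vec_poly v" using nz by simp
    thus "u = v" using c vec_poly_inj by (auto simp: inj_on_def)
  qed
  have surj: "T ` carrier (module_vec TYPE('a) ?d) = carrier (?V\<lparr>carrier := ?C\<rparr>)"
  proof
    show "T ` carrier (module_vec TYPE('a) ?d) \<subseteq> carrier (?V\<lparr>carrier := ?C\<rparr>)"
      using T by (auto simp: module_vec_simps iff)
    show "carrier (?V\<lparr>carrier := ?C\<rparr>) \<subseteq> T ` carrier (module_vec TYPE('a) ?d)"
    proof
      fix c assume "c \<in> carrier (?V\<lparr>carrier := ?C\<rparr>)"
      hence c: "c \<in> carrier_vec m" "g dvd vec_poly c" by (auto simp: iff)
      then obtain f where f: "vec_poly c = g * f" by (auto elim: dvdE)
      have "f = 0 \<or> degree f < ?d"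
        using vec_poly_degree[OF c(1)] f nz deg by (cases "f = 0") (auto simp: degree_mult_eq)
      then obtain u where u: "u \<in> carrier_vec ?d" "vec_poly u = f" by (rule vec_poly_surj)
      have "T u = c" using u c f by (intro TI) auto
      thus "c \<in> T ` carrier (module_vec TYPE('a) ?d)" using u by (auto simp: module_vec_simps)
    qed
  qed
  have "U.dim = W.dim" by (rule T.dim_eq[OF U.fin_dim inj surj])
  thus ?thesis using sub U.dim_is_n by (simp add: linear_code_def)
qed

lemma parity_check_polynomial_unique:
  assumes "parity_check_polynomial \<mu> m C h" "parity_check_polynomial \<mu> m D h" "m > 0"
  shows "C = D"
proof -
  obtain g g' where "g * h = binom_poly m \<mu>" "C = ideal_code \<mu> m g"
      "g' * h = binom_poly m \<mu>" "D = ideal_code \<mu> m g'"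
    using assms(1,2) by (auto simp: parity_check_polynomial_def)
  moreover have "binom_poly m \<mu> \<noteq> 0" using degree_binom_poly[of m \<mu>] assms(3) by auto
  ultimately show ?thesis by (metis mult_cancel_right mult_zero_right)
qed

text \<open>In particular such a code exists for \<open>h = x\<^sup>d - a\<close> and \<open>m = d t\<close>, \<open>\<mu> = a\<^sup>t\<close>.\<close>

lemma constacyclic_code_exists:
  fixes a :: "'a :: field"
  assumes "a \<noteq> 0" "d > 0" "t > 0"
  shows "\<exists>C. linear_code (d * t) d C \<and> constacyclic (a ^ t) C \<and>
           parity_check_polynomial (a ^ t) (d * t) C (binom_poly d a)"
proof -
  have m: "d * t > 0" using assms by simp
  have "monom 1 d - [:a:] dvd monom 1 d ^ t - [:a:] ^ t"
    by (metis dvd_triv_left power_diff_sumr2)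
  also have "monom 1 d ^ t - [:a:] ^ t = binom_poly (d * t) (a ^ t)"
    by (simp add: binom_poly_def monom_power poly_const_pow mult.commute)
  finally obtain g where g: "g * binom_poly d a = binom_poly (d * t) (a ^ t)"
    unfolding binom_poly_def by (metis dvdE mult.commute)
  have "lead_coeff g = 1"
    using arg_cong[OF g, of lead_coeff] lead_coeff_binom_poly[OF assms(2), of a]
      lead_coeff_binom_poly[OF m, of "a ^ t"] by (simp only: lead_coeff_mult) simp
  moreover have "linear_code (d * t) d (ideal_code (a ^ t) (d * t) g)"
    using linear_code_ideal_code[OF g m] degree_binom_poly[OF assms(2), of a] by simp
  moreover have "constacyclic (a ^ t) (ideal_code (a ^ t) (d * t) g)"
    using assms m by (intro constacyclic_ideal_code) (auto simp flip: g)
  ultimately show ?thesis using g by (auto simp: parity_check_polynomial_def)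
qed

end

theory Submission
  imports Defs
begin

text \<open>Write \<open>d = l\<^sup>n\<^sup>-\<^sup>r\<close>, \<open>t = l\<^sup>r\<close> and \<open>a = \<mu>\<^sub>k\<^sub>+\<^sub>r\<close>, so that \<open>\<mu>\<^sub>k = a\<^sup>t\<close>. The generator polynomial
  \<open>(x\<^sup>d\<^sup>t - a\<^sup>t) / (x\<^sup>d - a)\<close> is supported in degrees divisible by \<open>d\<close>, so its multiples of
  degree less than \<open>d t\<close> are exactly the words \<open>(u, a u, \<dots>, a\<^sup>t\<^sup>-\<^sup>1 u)\<close> with \<open>u\<close> an arbitrary vector
  of length \<open>d\<close>. Such a word has \<open>t\<close> times the weight of \<open>u\<close>, hence the weight distribution is that
  of the full space \<open>F\<^sup>d\<close>, stretched by \<open>t\<close>.\<close>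

text \<open>This is multiplication by the generator polynomial in vector form. With
  \<open>d = dim_vec u\<close>, block \<open>e\<close> contributes \<open>a ^ e\<close> times
  \<open>vec_poly u\<close>, shifted up by \<open>d * (t - 1 - e)\<close> degrees.\<close>

definition scaled_repetition :: "'a :: field \<Rightarrow> nat \<Rightarrow> 'a vec \<Rightarrow> 'a vec" where
  "scaled_repetition a t u =
     vec (dim_vec u * t) (\<lambda>i. a ^ (i div dim_vec u) * u $ (i mod dim_vec u))"

section \<open>Polynomials of scaled repetitions\<close>

lemma scaled_repetition_carrier:
  "u \<in> carrier_vec d \<Longrightarrow> scaled_repetition a t u \<in> carrier_vec (d * t)"
  by (auto simp: scaled_repetition_def)

text \<open>\<open>vec_poly\<close> reads coordinates backwards; this reversal splits into reversing
  the order of the blocks and reversing inside each block.\<close>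

lemma reversed_index_div_mod:
  fixes d t j :: nat
  assumes "d > 0" "j < d * t"
  shows "(d * t - 1 - j) div d = t - 1 - j div d"
    and "(d * t - 1 - j) mod d = d - 1 - j mod d"
proof -
  have lt: "j div d < t" using assms by (simp add: less_mult_imp_div_less mult.commute)
  have m: "j mod d < d" using assms by simp
  \<comment> \<open>\<open>e\<close> is the number of the reversed block; writing \<open>t\<close>
    as a sum avoids truncated subtraction.\<close>
  obtain e where e: "t = j div d + 1 + e" using lt by (metis Suc_eq_plus1 less_iff_Suc_add add_Suc)
  have "d * t = d * (j div d) + d + d * e" by (subst e) (simp add: distrib_left)
  moreover have "j = d * (j div d) + j mod d" by simp
  ultimately have eq: "d * t - 1 - j = d * e + (d - 1 - j mod d)" using m by linarith
  have "d - 1 - j mod d < d" using assms by simp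
  thus "(d * t - 1 - j) div d = t - 1 - j div d" "(d * t - 1 - j) mod d = d - 1 - j mod d"
    unfolding eq using e assms by simp_all
qed

lemma coeff_vec_poly_scaled_repetition:
  assumes u: "u \<in> carrier_vec d" and d: "d > 0"
  shows "coeff (vec_poly (scaled_repetition a t u)) j =
    (if j < d * t then a ^ (t - 1 - j div d) * coeff (vec_poly u) (j mod d) else 0)"
proof (cases "j < d * t")
  case True
  have "j mod d < d" using d by simp
  moreover have "d * t - 1 - j < d * t" using True by simp
  ultimately show ?thesis
    using True u reversed_index_div_mod[OF d True]
    by (simp add: coeff_vec_poly scaled_repetition_def)
next
  case False
  thus ?thesis using u by (simp add: coeff_vec_poly scaled_repetition_def)
qed

lemma coeff_binom_poly_mult:
  "coeff (binom_poly m b * p) j = (if m \<le> j then coeff p (j - m) else 0) - b * coeff p j"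
  by (simp add: binom_poly_def left_diff_distrib coeff_monom_mult)

text \<open>A finite geometric sum with ratio terms \<open>a\<close> and \<open>x^d\<close>,
  multiplied by \<open>vec_poly u\<close>. The cross-multiplied form avoids constructing the
  quotient.\<close>

lemma binom_poly_mult_scaled_repetition:
  assumes u: "u \<in> carrier_vec d" and d: "d > 0" and t: "t > 0"
  shows "binom_poly d a * vec_poly (scaled_repetition a t u) =
    binom_poly (d * t) (a ^ t) * vec_poly u"
proof (rule poly_eqI)
  fix j
  let ?p = "vec_poly (scaled_repetition a t u)"
  note cf = coeff_vec_poly_scaled_repetition[OF u d, of a t]
  have dt: "d \<le> d * t" using t by simp
  have at: "a * a ^ (t - Suc 0) = a ^ t" using t by (metis Suc_pred power_Suc)
  have u0: "coeff (vec_poly u) i = 0" if "i \<ge> d" for i using that u by (simp add: coeff_vec_poly)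
  \<comment> \<open>In the first range only the constant terms of the binomials act, giving
    \<open>- a ^ t\<close> on both sides. In the second, neighbouring blocks telescope to 0. In the
    third, only the leading monomials act, and the power of \<open>a\<close> is 0. Beyond that
    everything vanishes.\<close>
  consider "j < d" | "d \<le> j" "j < d * t" | "d * t \<le> j" "j < d * t + d" | "d * t + d \<le> j"
    by linarith
  thus "coeff (binom_poly d a * ?p) j = coeff (binom_poly (d * t) (a ^ t) * vec_poly u) j"
  proof cases
    case 1
    hence "j < d * t" using dt by linarith
    thus ?thesis using 1 by (simp add: coeff_binom_poly_mult cf at flip: mult.assoc)
  next
    case 2
    have lt: "j div d < t" using 2 d by (simp add: less_mult_imp_div_less mult.commute)
    have shift: "j div d = Suc ((j - d) div d)" "(j - d) mod d = j mod d"
      using 2 d by (simp_all add: le_div_geq le_mod_geq)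
    have "t - 1 - (j - d) div d = Suc (t - 1 - j div d)" using lt shift(1) by linarith
    hence "a ^ (t - 1 - (j - d) div d) = a * a ^ (t - 1 - j div d)" by simp
    moreover have "j - d < d * t" using 2 by linarith
    ultimately show ?thesis using 2 shift(2) by (simp add: coeff_binom_poly_mult cf u0)
  next
    case 3
    have "d * t = d + d * (t - 1)" using t by (cases t) auto
    hence "j - d = (j - d * t) + d * (t - 1)" "j - d * t < d" using 3 by linarith+
    hence "(j - d) div d = t - 1" "(j - d) mod d = j - d * t" using d by simp_all
    moreover have "j - d < d * t" "d \<le> j" using 3 dt by linarith+
    ultimately show ?thesis using 3 by (simp add: coeff_binom_poly_mult cf u0)
  next
    case 4
    hence "d \<le> j" "d * t \<le> j" "d * t \<le> j - d" "d \<le> j - d * t" using dt by linarith+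
    thus ?thesis by (simp add: coeff_binom_poly_mult cf u0)
  qed
qed

text \<open>Cancelling \<open>binom_poly d a\<close> shows that scaled repetition is multiplication
  by \<open>g\<close>. As \<open>degree g + d = d * t\<close>, the cofactor of any codeword has
  degree below \<open>d\<close> or is zero, so it is some \<open>vec_poly u\<close>.\<close>

lemma code_eq_scaled_repetitions:
  fixes a :: "'a :: field"
  assumes d: "d > 0" and t: "t > 0"
    and C: "parity_check_polynomial (a ^ t) (d * t) C (binom_poly d a)"
  shows "C = scaled_repetition a t ` carrier_vec d"
proof -
  obtain g where g: "g * binom_poly d a = binom_poly (d * t) (a ^ t)"
    and Cg: "C = ideal_code (a ^ t) (d * t) g"
    using C by (auto simp: parity_check_polynomial_def)
  have h0: "binom_poly d a \<noteq> 0" using degree_binom_poly[OF d, of a] d by auto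
  have m0: "binom_poly (d * t) (a ^ t) \<noteq> 0"
    using degree_binom_poly[of "d * t" "a ^ t"] d t by auto
  have g0: "g \<noteq> 0" using g m0 by auto
  have deg: "degree g + d = d * t"
    using degree_mult_eq[OF g0 h0] g degree_binom_poly[OF d, of a]
      degree_binom_poly[of "d * t" "a ^ t"] d t by simp
  have iff: "c \<in> C \<longleftrightarrow> c \<in> carrier_vec (d * t) \<and> g dvd vec_poly c" for c
    unfolding Cg by (rule ideal_code_iff) (simp flip: g)
  have rep: "vec_poly (scaled_repetition a t u) = g * vec_poly u" if "u \<in> carrier_vec d" for u
  proof -
    have "binom_poly d a * vec_poly (scaled_repetition a t u) = binom_poly d a * (g * vec_poly u)"
      by (simp add: binom_poly_mult_scaled_repetition[OF that d t] ac_simps flip: g)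
    thus ?thesis using h0 by simp
  qed
  show ?thesis
  proof
    show "scaled_repetition a t ` carrier_vec d \<subseteq> C"
      using rep by (auto simp: iff scaled_repetition_carrier)
    show "C \<subseteq> scaled_repetition a t ` carrier_vec d"
    proof
      fix c assume "c \<in> C"
      then obtain f where c: "c \<in> carrier_vec (d * t)" and f: "vec_poly c = g * f"
        by (auto simp: iff elim: dvdE)
      have "f = 0 \<or> degree f < d"
        using vec_poly_degree[OF c] f g0 deg by (cases "f = 0") (auto simp: degree_mult_eq)
      then obtain u where u: "u \<in> carrier_vec d" "vec_poly u = f" by (rule vec_poly_surj)
      have "c = scaled_repetition a t u"
        using vec_poly_inj rep[OF u(1)] u f c
        by (intro inj_onD[OF vec_poly_inj[of "d * t"]]) (auto simp: scaled_repetition_carrier)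
      thus "c \<in> scaled_repetition a t ` carrier_vec d" using u by auto
    qed
  qed
qed

section \<open>Injectivity and weights of scaled repetitions\<close>

lemma inj_on_scaled_repetition:
  assumes "t > 0"
  shows "inj_on (scaled_repetition a t) (carrier_vec d)"
proof (rule inj_onI)
  fix u v :: "'a vec"
  assume uv: "u \<in> carrier_vec d" "v \<in> carrier_vec d"
    "scaled_repetition a t u = scaled_repetition a t v"
  show "u = v"
  proof (rule eq_vecI)
    fix i assume "i < dim_vec v"
    hence i: "i < d" using uv by simp
    \<comment> \<open>Since \<open>t > 0\<close>, block 0 exists, and it is \<open>u\<close> itself,
      unscaled.\<close>
    moreover have "d \<le> d * t" using assms by simp
    ultimately have "i < d * t" by linarith
    thus "u $ i = v $ i"
      using arg_cong[OF uv(3), of "\<lambda>w. w $ i"] uv i by (simp add: scaled_repetition_def)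
  qed (use uv in auto)
qed

text \<open>Powers of a nonzero \<open>a\<close> are nonzero, so each of the \<open>t\<close> blocks
  has the support of \<open>u\<close>; division with remainder by \<open>d\<close> separates block
  and position.\<close>

lemma hamming_weight_scaled_repetition:
  assumes u: "u \<in> carrier_vec d" and d: "d > 0" and a: "a \<noteq> 0"
  shows "hamming_weight (scaled_repetition a t u) = t * hamming_weight u"
proof -
  let ?S = "{i. i < d \<and> u $ i \<noteq> 0}"
  let ?R = "{i. i < d * t \<and> u $ (i mod d) \<noteq> 0}"
  have "bij_betw (\<lambda>i. (i div d, i mod d)) ?R ({..<t} \<times> ?S)"
  proof (rule bij_betw_byWitness[where f' = "\<lambda>(e, j). j + d * e"])
    show "(\<lambda>(e, j). j + d * e) ` ({..<t} \<times> ?S) \<subseteq> ?R"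
    proof (clarsimp)
      fix e j assume "e < t" "j < d"
      moreover from this have "d * Suc e \<le> d * t" by (intro mult_le_mono2) simp
      ultimately show "j + d * e < d * t" by simp
    qed
  qed (use d in \<open>auto simp: less_mult_imp_div_less mult.commute\<close>)
  hence "card ?R = t * card ?S" by (simp add: bij_betw_same_card card_cartesian_product)
  moreover have "{i. i < dim_vec (scaled_repetition a t u) \<and> scaled_repetition a t u $ i \<noteq> 0} = ?R"
    using u a by (auto simp: scaled_repetition_def)
  ultimately show ?thesis using u by (simp add: hamming_weight_def)
qed

section \<open>Counting vectors of the full space by weight\<close>

lemma hamming_weight_le: "u \<in> carrier_vec d \<Longrightarrow> hamming_weight u \<le> d"
  unfolding hamming_weight_def
  by (rule order.trans[OF card_mono[of "{..<d}"]]) auto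

text \<open>Restriction to \<open>S\<close> turns these vectors into free choices of nonzero values
  on \<open>S\<close>; extension by zero is the inverse.\<close>

lemma card_vec_support:
  fixes S :: "nat set"
  assumes "S \<subseteq> {..<d}"
  shows "card {u \<in> carrier_vec d. {i. i < d \<and> u $ i \<noteq> (0 :: 'a :: {zero, finite})} = S} =
    (CARD('a) - 1) ^ card S"
proof -
  let ?A = "{u \<in> carrier_vec d. {i. i < d \<and> u $ i \<noteq> (0 :: 'a)} = S}"
  let ?B = "S \<rightarrow>\<^sub>E (UNIV - {0 :: 'a})"
  have "bij_betw (\<lambda>u. restrict (($) u) S) ?A ?B"
  proof (rule bij_betw_byWitness[where f' = "\<lambda>f. vec d (\<lambda>i. if i \<in> S then f i else 0)"])
    show "\<forall>u\<in>?A. vec d (\<lambda>i. if i \<in> S then restrict (($) u) S i else 0) = u"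
      by (auto intro!: eq_vecI)
    show "\<forall>f\<in>?B. restrict (($) (vec d (\<lambda>i. if i \<in> S then f i else 0))) S = f"
    proof
      fix f assume f: "f \<in> ?B"
      show "restrict (($) (vec d (\<lambda>i. if i \<in> S then f i else 0))) S = f"
      proof
        fix i show "restrict (($) (vec d (\<lambda>i. if i \<in> S then f i else 0))) S i = f i"
          using f assms by (cases "i \<in> S") (auto simp: PiE_def extensional_def)
      qed
    qed
    show "(\<lambda>u. restrict (($) u) S) ` ?A \<subseteq> ?B" by auto
    show "(\<lambda>f. vec d (\<lambda>i. if i \<in> S then f i else 0)) ` ?B \<subseteq> ?A"
    proof (rule image_subsetI)
      fix f assume f: "f \<in> ?B"
      have "i < d" "f i \<noteq> 0" if "i \<in> S" for i using that f assms by auto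
      thus "vec d (\<lambda>i. if i \<in> S then f i else 0) \<in> ?A" by (auto split: if_splits)
    qed
  qed
  hence "card ?A = card ?B" by (rule bij_betw_same_card)
  also have "\<dots> = (CARD('a) - 1) ^ card S"
    using assms finite_subset[OF assms] by (simp add: card_PiE card_Diff_singleton)
  finally show ?thesis .
qed

lemma weight_count_carrier_vec:
  "weight_count (carrier_vec d :: 'a :: {zero, finite} vec set) j =
    (d choose j) * (CARD('a) - 1) ^ j"
proof -
  let ?F = "\<lambda>S. {u \<in> carrier_vec d. {i. i < d \<and> u $ i \<noteq> (0 :: 'a)} = S}"
  let ?I = "{S. S \<subseteq> {..<d} \<and> card S = j}"
  have fin: "finite (carrier_vec d :: 'a vec set)"
  proof (rule finite_subset)
    show "carrier_vec d \<subseteq> vec d ` ({..<d} \<rightarrow>\<^sub>E (UNIV :: 'a set))"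
    proof
      fix u :: "'a vec" assume "u \<in> carrier_vec d"
      hence "u = vec d (restrict (($) u) {..<d})" by (auto intro!: eq_vecI)
      thus "u \<in> vec d ` ({..<d} \<rightarrow>\<^sub>E UNIV)" by (rule image_eqI[of u "vec d"]) auto
    qed
  qed (auto intro!: finite_PiE)
  \<comment> \<open>Sorting by support gives a disjoint union over the \<open>j\<close>-subsets of
    the coordinates.\<close>
  have "{u \<in> carrier_vec d. hamming_weight (u :: 'a vec) = j} = (\<Union>S\<in>?I. ?F S)"
    by (auto simp: hamming_weight_def)
  hence "weight_count (carrier_vec d :: 'a vec set) j = card (\<Union>S\<in>?I. ?F S)"
    by (simp add: weight_count_def)
  also have "\<dots> = (\<Sum>S\<in>?I. card (?F S))"
    using fin by (intro card_UN_disjoint) auto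
  also have "\<dots> = (\<Sum>S\<in>?I. (CARD('a) - 1) ^ j)"
    by (intro sum.cong) (auto simp: card_vec_support)
  also have "\<dots> = (d choose j) * (CARD('a) - 1) ^ j"
    by (simp add: n_subsets)
  finally show ?thesis .
qed

lemma weight_count_scaled_repetitions:
  fixes a :: "'a :: {field, finite}"
  assumes "d > 0" "t > 0" "a \<noteq> 0"
  shows "weight_count (scaled_repetition a t ` carrier_vec d) (t * j) =
      (d choose j) * (CARD('a) - 1) ^ j"
    and "(\<nexists>j. j \<le> d \<and> i = t * j) \<Longrightarrow>
      weight_count (scaled_repetition a t ` carrier_vec d) i = 0"
proof -
  let ?C = "scaled_repetition a t ` carrier_vec d"
  have "{c \<in> ?C. hamming_weight c = t * j} =
      scaled_repetition a t ` {u \<in> carrier_vec d. hamming_weight u = j}"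
    using assms by (auto simp: hamming_weight_scaled_repetition)
  hence "weight_count ?C (t * j) = weight_count (carrier_vec d :: 'a vec set) j"
    unfolding weight_count_def
    by (auto intro!: card_image inj_on_subset[OF inj_on_scaled_repetition[OF assms(2)]])
  thus "weight_count ?C (t * j) = (d choose j) * (CARD('a) - 1) ^ j"
    by (simp add: weight_count_carrier_vec)
  assume "\<nexists>j. j \<le> d \<and> i = t * j"
  \<comment> \<open>A codeword of weight \<open>i\<close> would come from some \<open>u\<close>, and
    \<open>hamming_weight u \<le> d\<close> would be an excluded \<open>j\<close>.\<close>
  hence "{c \<in> ?C. hamming_weight c = i} = {}"
    using assms hamming_weight_le by (fastforce simp: hamming_weight_scaled_repetition)
  thus "weight_count ?C i = 0" unfolding weight_count_def by (simp only: card.empty)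
qed

theorem theorem4p3:
  fixes \<mu> :: "nat \<Rightarrow> 'a :: {field, finite}"
    and q l s n k r :: nat
    and C :: "'a vec set"
  assumes "q = CARD('a)"
    and "prime l"
    and "coprime l q"
    and "s = multiplicity l (q - 1)"
    and "s \<ge> 1"
    and "l = 2 \<longrightarrow> s \<noteq> 1"
    and "primitive_root_of_unity (l ^ s) (\<mu> s)"
    and "\<forall>j\<le>s. \<mu> j = \<mu> s ^ (l ^ (s - j))"
    and "n \<ge> 1"
    and "1 \<le> k" and "k \<le> s"
    and "r = min n (s - k)"
    and "linear_code (l ^ n) (l ^ (n - r)) C"
    and "constacyclic (\<mu> k) C"
    and "parity_check_polynomial (\<mu> k) (l ^ n) C (binom_poly (l ^ (n - r)) (\<mu> (k + r)))"
  shows "(\<forall>j\<le>l ^ (n - r). weight_count C (l ^ r * j) = (l ^ (n - r) choose j) * (q - 1) ^ j) \<and>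
         (\<forall>i. (\<nexists>j. j \<le> l ^ (n - r) \<and> i = l ^ r * j) \<longrightarrow> weight_count C i = 0)"
proof -
  let ?d = "l ^ (n - r)" and ?t = "l ^ r" and ?a = "\<mu> (k + r)"
  have l: "l > 0" using assms(2) by (rule prime_gt_0_nat)
  have pos: "?d > 0" "?t > 0" using l by auto
  have r: "r \<le> n" "k + r \<le> s" using assms(11,12) by auto
  have len: "l ^ n = ?d * ?t" using r by (simp flip: power_add)
  \<comment> \<open>The bound \<open>k + r \<le> s\<close> makes the subtractions exact, so
    \<open>\<mu> k\<close> is the \<open>l ^ r\<close>-th power of
    \<open>\<mu> (k + r)\<close>.\<close>
  have "s - k = (s - (k + r)) + r" using r by simp
  hence exp: "l ^ (s - k) = l ^ (s - (k + r)) * ?t" by (simp only: power_add)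
  have "\<mu> k = \<mu> s ^ (l ^ (s - k))" "?a = \<mu> s ^ (l ^ (s - (k + r)))"
    using assms(8,11) r(2) by blast+
  hence "\<mu> k = ?a ^ ?t" by (simp only: exp power_mult)
  moreover have "\<mu> k \<noteq> 0" using assms(14) by (simp add: constacyclic_def)
  \<comment> \<open>If \<open>?a\<close> were zero, its positive power \<open>\<mu> k\<close> would
    be zero too.\<close>
  ultimately have a: "?a \<noteq> 0" and "\<mu> k = ?a ^ ?t" using pos by (auto simp: power_0_left)
  hence "C = scaled_repetition ?a ?t ` carrier_vec ?d"
    using code_eq_scaled_repetitions[OF pos] assms(15) len by simp
  thus ?thesis
    using weight_count_scaled_repetitions[OF pos a] assms(1) by auto
qed

end
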